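(* If $G$ is a non-trivial connected interval graph, then $\sigma^{\boxtimes}_V(G)=1$.
   Context: All graphs are finite and simple; non-trivial means having at least two vertices. An interval representation of a graph is a family of (closed) intervals of the real line assigned to the vertices so that two distinct vertices are adjacent if and only if the corresponding intervals intersect. A graph is an interval graph if it has an interval representation. A function $f: V(P)\to V(H)$ is a weak homomorphism $f:P\to H$ if for every edge $uv\in E(P)$ either $f(u)f(v)\in E(H)$ or $f(u)=f(v)$; it is surjective if $f(V(P))=V(H)$. For weak homomorphisms $f,g:P\to H$ put $m_P(f,g)=\min\{d_H(f(u),g(u)) \mid u\in V(P)\}$, where $d_H$ is the shortest-path distance. For a connected graph $H$, the strong vertex span is $\sigma^{\boxtimes}_V(H)=\max\{m_P(f,g) \mid f,g:P\to H$ are surjective weak homomorphisms and $P$ is a path$\}$. *)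

theory Defs
  imports "Graph_Theory.Graph_Theory"
begin

text \<open>
  A finite simple graph is a \<^locale>\<open>pair_graph\<close>: an edge is a pair of opposite arcs.
\<close>

definition interval_representation :: "'a pair_pre_digraph \<Rightarrow> ('a \<Rightarrow> real set) \<Rightarrow> bool" where
  "interval_representation G I \<longleftrightarrow>
     (\<forall>v \<in> pverts G. \<exists>a b. a \<le> b \<and> I v = {a..b}) \<and>
     (\<forall>u \<in> pverts G. \<forall>v \<in> pverts G. u \<noteq> v \<longrightarrow> ((u, v) \<in> parcs G \<longleftrightarrow> I u \<inter> I v \<noteq> {}))"

definition interval_graph :: "'a pair_pre_digraph \<Rightarrow> bool" where
  "interval_graph G \<longleftrightarrow> pair_graph G \<and> (\<exists>I. interval_representation G I)"

definition path_graph :: "'a pair_pre_digraph \<Rightarrow> bool" where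
  "path_graph P \<longleftrightarrow>
     (\<exists>p. p \<noteq> [] \<and> distinct p \<and> pverts P = set p \<and>
          parcs P = set (vwalk_arcs p) \<union> (set (vwalk_arcs p))\<inverse>)"

definition weak_hom :: "'b pair_pre_digraph \<Rightarrow> 'a pair_pre_digraph \<Rightarrow> ('b \<Rightarrow> 'a) \<Rightarrow> bool" where
  "weak_hom P H f \<longleftrightarrow>
     f ` pverts P \<subseteq> pverts H \<and>
     (\<forall>(u, v) \<in> parcs P. (f u, f v) \<in> parcs H \<or> f u = f v)"

definition surj_weak_hom :: "'b pair_pre_digraph \<Rightarrow> 'a pair_pre_digraph \<Rightarrow> ('b \<Rightarrow> 'a) \<Rightarrow> bool" where
  "surj_weak_hom P H f \<longleftrightarrow> weak_hom P H f \<and> f ` pverts P = pverts H"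

text \<open>
  Least number of arcs on a walk from \<open>u\<close> to \<open>v\<close>; it is \<open>\<infinity>\<close> if there is none.
\<close>

definition gdist :: "'a pair_pre_digraph \<Rightarrow> 'a \<Rightarrow> 'a \<Rightarrow> ereal" where
  "gdist H u v = wf_digraph.\<mu> (with_proj H) (\<lambda>_. 1) u v"

definition hom_dist ::
    "'b pair_pre_digraph \<Rightarrow> 'a pair_pre_digraph \<Rightarrow> ('b \<Rightarrow> 'a) \<Rightarrow> ('b \<Rightarrow> 'a) \<Rightarrow> ereal" where
  "hom_dist P H f g = Min ((\<lambda>u. gdist H (f u) (g u)) ` pverts P)"

text \<open>
  It suffices to let \<open>P\<close> range over paths with vertices of type \<^typ>\<open>nat\<close>, since every finite
  path is isomorphic to one of these.  For finite connected \<open>H\<close> the set below is finite, as its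
  members are distances between vertices of \<open>H\<close>, and it is nonempty, so that \<^const>\<open>Max\<close> is
  its greatest element.
\<close>

definition strong_vertex_span :: "'a pair_pre_digraph \<Rightarrow> ereal" where
  "strong_vertex_span H =
     Max {hom_dist P H f g | (P :: nat pair_pre_digraph) f g.
            path_graph P \<and> surj_weak_hom P H f \<and> surj_weak_hom P H g}"

end

theory Submission
  imports Defs
begin

text \<open>
  Lower bound: if \<open>w\<close> is a closed walk through all vertices, then \<open>w\<close> and \<open>w\<close> shifted by
  one step are surjective and differ at every time, since consecutive vertices of \<open>w\<close> are
  adjacent.  Upper bound: if the intervals of \<open>f u\<close> and \<open>g u\<close> are disjoint for all \<open>u\<close>, then
  one of them, say that of \<open>f u\<close>, lies to the left of the other at the start of the path.
  Weak homomorphisms cannot change this order within one step without an intersection, so it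
  persists; but it fails when \<open>f u\<close> is the vertex with the largest left endpoint.
\<close>

text \<open>Induction along the list. It later carries the left-right order of two disjoint
  intervals from the first vertex of a path to all others.\<close>

lemma vwalk_arcs_invariant:
  assumes "\<And>x y. (x, y) \<in> set (vwalk_arcs p) \<Longrightarrow> Q x \<Longrightarrow> Q y"
    and "Q (hd p)" and "u \<in> set p"
  shows "Q u"
  using assms
proof (induction p rule: vwalk_arcs.induct)
  case (3 x y xs)
  have "Q y" using "3.prems"(1)[of x y] "3.prems"(2) by simp
  moreover have "Q u" if "u \<in> set (y # xs)"
    using "3.IH" "3.prems"(1) \<open>Q y\<close> that by auto
  ultimately show ?case using "3.prems" by auto
qed auto

lemma in_set_vwalk_arcs_iff_nth:
  "(x, y) \<in> set (vwalk_arcs p) \<longleftrightarrow> (\<exists>i. Suc i < length p \<and> x = p ! i \<and> y = p ! Suc i)"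
proof (induction p rule: vwalk_arcs.induct)
  case (3 a b xs)
  have split: "(\<exists>i. Q i) \<longleftrightarrow> Q 0 \<or> (\<exists>i. Q (Suc i))" for Q :: "nat \<Rightarrow> bool"
    by (metis not0_implies_Suc)
  show ?case using "3.IH" by (subst split) auto
qed auto

context pair_graph
begin

lemma gdist_self_or_adjacent_le_1:
  assumes "u \<in> pverts G" and "(u, v) \<in> parcs G \<or> u = v"
  shows "gdist G u v \<le> 1"
proof (cases "u = v")
  case True
  then have "awalk u [] v" using assms by (simp add: awalk_Nil_iff)
  from min_cost_le_walk_cost[OF this, of "\<lambda>_. 1"] show ?thesis
    unfolding gdist_def by (simp add: order_trans)
next
  case False
  then have "awalk u [(u, v)] v" using assms arc_implies_awalk[of "(u, v)"] by simp
  from min_cost_le_walk_cost[OF this, of "\<lambda>_. 1"] show ?thesis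
    unfolding gdist_def by (simp add: awalk_cost_def one_ereal_def)
qed

text \<open>The cost of a walk under unit weights is its length, and only the empty walk has length
  0; that walk joins a vertex to itself.\<close>

lemma gdist_ge_1:
  assumes "u \<noteq> v"
  shows "1 \<le> gdist G u v"
  unfolding gdist_def \<mu>_def
proof (rule INF_greatest)
  fix p assume "p \<in> {p. awalk u p v}"
  then have "p \<noteq> []" using assms by (auto simp: awalk_Nil_iff)
  then have "1 \<le> awalk_cost (\<lambda>_. 1) p" by (cases p) (auto simp: awalk_cost_def sum_list_triv)
  then show "1 \<le> ereal (awalk_cost (\<lambda>_. 1) p)" by (simp add: one_ereal_def)
qed

text \<open>Induction on the set \<open>S\<close> of vertices still to be visited: each new vertex
  is reached by a detour from \<open>u\<close> and back, appended to the closed walk found so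
  far.\<close>

lemma closed_spanning_vwalk:
  assumes "Digraph_Component.connected (with_proj G)" and "u \<in> pverts G"
  obtains w where "vwalk w (with_proj G)" "hd w = u" "last w = u" "set w = pverts G"
proof -
  \<comment> \<open>Since every arc has its opposite, connectedness gives directed walks both to and
    from \<open>u\<close>.\<close>
  have reach: "x \<rightarrow>\<^sup>*\<^bsub>with_proj G\<^esub> y" if "x \<in> pverts G" "y \<in> pverts G" for x y
    using symmetric_connected_imp_strongly_connected[OF sym_arcs assms(1)] that
    by (simp add: strongly_connected_def)
  have "\<exists>w. vwalk w (with_proj G) \<and> hd w = u \<and> last w = u \<and> S \<subseteq> set w"
    if "finite S" "S \<subseteq> pverts G" for S
    using that
  proof (induction S)
    case empty
    have "vwalk [u] (with_proj G)" using assms(2) by (auto simp: vwalk_def)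
    then show ?case by force
  next
    case (insert v S)
    then obtain w where w: "vwalk w (with_proj G)" "hd w = u" "last w = u" "S \<subseteq> set w" by auto
    obtain q where q: "vwalk q (with_proj G)" "hd q = u" "last q = v"
      using reach[OF assms(2), of v] insert.prems reachable_vwalk_conv by auto
    obtain r where r: "vwalk r (with_proj G)" "hd r = v" "last r = u"
      using reach[OF _ assms(2), of v] insert.prems reachable_vwalk_conv by auto
    have ne: "w \<noteq> []" "q \<noteq> []" "r \<noteq> []" using w q r by auto
    have wq: "vwalk (w \<oplus> q) (with_proj G)" "hd (w \<oplus> q) = u" "last (w \<oplus> q) = v"
      using w q ne by (auto simp: vwalk_joinI_vwalk' joinable_def vwalk_join_hd vwalk_join_last)
    then have "vwalk ((w \<oplus> q) \<oplus> r) (with_proj G)" "hd ((w \<oplus> q) \<oplus> r) = u"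
      "last ((w \<oplus> q) \<oplus> r) = u"
      using r ne by (auto simp: vwalk_joinI_vwalk' joinable_def vwalk_join_hd vwalk_join_last)
    moreover have "v \<in> set (w \<oplus> q)" using wq ne last_in_set[of "w \<oplus> q"] by auto
    then have "insert v S \<subseteq> set ((w \<oplus> q) \<oplus> r)" using w(4) by (auto simp: vwalk_join_def)
    ultimately show ?case by blast
  qed
  \<comment> \<open>A walk never leaves \<open>pverts G\<close>, so the inclusion becomes an
    equality.\<close>
  from this[of "pverts G"] show thesis using that pair_finite_verts by (auto simp: vwalk_def)
qed

lemma surj_weak_homs_everywhere_distinct:
  assumes "Digraph_Component.connected (with_proj G)" and "card (pverts G) \<ge> 2"
  obtains P :: "nat pair_pre_digraph" and f g where
    "path_graph P" "surj_weak_hom P G f" "surj_weak_hom P G g"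
    "\<And>i. i \<in> pverts P \<Longrightarrow> f i \<noteq> g i"
proof -
  obtain u where "u \<in> pverts G" using assms(2) by fastforce
  then obtain w where w: "vwalk w (with_proj G)" "hd w = u" "last w = u" "set w = pverts G"
    using closed_spanning_vwalk[OF assms(1)] by metis
  define n where "n = length w - 1"
  \<comment> \<open>Two distinct vertices force at least one arc, so the path on \<open>n\<close>
    vertices defined below is nonempty.\<close>
  have "2 \<le> length w" using card_length[of w] w(4) assms(2) by simp
  then have len: "length w = Suc n" "0 < n" by (auto simp: n_def)
  have closed: "w ! 0 = w ! n"
    using w(2,3) len by (metis hd_conv_nth last_conv_nth n_def list.size(3) nat.distinct(1))
  have adj: "(w ! i, w ! Suc i) \<in> parcs G" if "i < n" for i
    using w(1) that len in_set_vwalk_arcs_iff_nth[of "w ! i" "w ! Suc i" w]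
    by (auto simp: vwalk_def)
  have range: "w ! i \<in> pverts G" if "i \<le> n" for i
    using nth_mem[of i w] len that unfolding w(4) by simp
  have cover: "\<exists>i\<le>n. v = w ! i" if "v \<in> pverts G" for v
    using that w(4) len by (metis in_set_conv_nth less_Suc_eq_le)
  \<comment> \<open>One vertex of \<open>P\<close> per arc of the closed walk: vertex
    \<open>i\<close> is sent to the tail of arc \<open>i\<close> by \<open>f\<close> and to its head
    by \<open>g\<close>.\<close>
  define P where "P = \<lparr>pverts = set [0..<n],
    parcs = set (vwalk_arcs [0..<n]) \<union> (set (vwalk_arcs [0..<n]))\<inverse>\<rparr>"
  have P: "pverts P = {..<n}"
    "\<And>i j. (i, j) \<in> parcs P \<Longrightarrow> i < n \<and> j < n \<and> (j = Suc i \<or> i = Suc j)"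
    by (auto simp: P_def in_set_vwalk_arcs_iff_nth)
  have sym: "(y, x) \<in> parcs G" if "(x, y) \<in> parcs G" for x y
    using that arcs_symmetric by auto
  have hom: "weak_hom P G h"
    if verts: "\<And>i. i < n \<Longrightarrow> h i \<in> pverts G"
      and steps: "\<And>i. Suc i < n \<Longrightarrow> (h i, h (Suc i)) \<in> parcs G" for h
  proof -
    have "(h i, h j) \<in> parcs G" if "(i, j) \<in> parcs P" for i j
      using P(2)[OF that] steps sym by blast
    then show ?thesis using P(1) verts by (auto simp: weak_hom_def)
  qed
  have "path_graph P"
    unfolding path_graph_def P_def using len by (intro exI[of _ "[0..<n]"]) auto
  moreover have "weak_hom P G ((!) w)"
    using adj range by (intro hom) auto
  moreover have "weak_hom P G (\<lambda>i. w ! Suc i)"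
    using adj range by (intro hom) auto
  moreover have "pverts G \<subseteq> (!) w ` pverts P"
  proof
    fix v assume "v \<in> pverts G"
    then obtain i where "i \<le> n" "v = w ! i" using cover by blast
    then show "v \<in> (!) w ` pverts P"
      \<comment> \<open>Position \<open>n\<close> is not a vertex of \<open>P\<close>; as the walk
        is closed, position 0 shows the same vertex.\<close>
      using closed len P(1) by (cases "i = n") (auto intro: image_eqI[of _ _ 0])
  qed
  moreover have "pverts G \<subseteq> (\<lambda>i. w ! Suc i) ` pverts P"
  proof
    fix v assume "v \<in> pverts G"
    then obtain i where "i \<le> n" "v = w ! i" using cover by blast
    moreover obtain m where "n = Suc m" using len by (cases n) auto
    \<comment> \<open>The shifted walk misses position 0, but its last value, at \<open>m\<close>,
      is \<open>w ! n\<close>, which equals \<open>w ! 0\<close>.\<close>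
    ultimately show "v \<in> (\<lambda>i. w ! Suc i) ` pverts P"
      using closed P(1) by (cases i) (auto intro: image_eqI[of _ _ m])
  qed
  moreover have "w ! i \<noteq> w ! Suc i" if "i \<in> pverts P" for i
    using that adj[of i] no_loops' P(1) by auto
  ultimately show thesis
    by (intro that[of P "(!) w" "\<lambda>i. w ! Suc i"]) (auto simp: surj_weak_hom_def weak_hom_def)
qed

text \<open>Only endpoints matter here: the two inequalities in the conclusion say that the
  intervals of \<open>f u\<close> and \<open>g u\<close> meet.\<close>

lemma interval_homs_meet:
  fixes l r :: "'a \<Rightarrow> real"
  assumes intervals: "\<And>v. v \<in> pverts G \<Longrightarrow> l v \<le> r v"
    and arcs: "\<And>u v. (u, v) \<in> parcs G \<Longrightarrow> l u \<le> r v \<and> l v \<le> r u"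
    and "pverts G \<noteq> {}"
    and P: "path_graph P" and f: "surj_weak_hom P G f" and g: "surj_weak_hom P G g"
  obtains u where "u \<in> pverts P" "l (f u) \<le> r (g u)" "l (g u) \<le> r (f u)"
proof -
  obtain p where p: "p \<noteq> []" "pverts P = set p" "set (vwalk_arcs p) \<subseteq> parcs P"
    using P by (auto simp: path_graph_def)
  \<comment> \<open>Stated for arbitrary \<open>f\<close> and \<open>g\<close>, so that it can be
    applied a second time with the roles exchanged.\<close>
  have never_left: False
    if f: "surj_weak_hom P G f" and g: "surj_weak_hom P G g"
      and disj: "\<And>u. u \<in> set p \<Longrightarrow> r (f u) < l (g u) \<or> r (g u) < l (f u)"
      and start: "r (f (hd p)) < l (g (hd p))" for f g
  proof -
    have step: "r (f y) < l (g y)" if xy: "(x, y) \<in> set (vwalk_arcs p)" and "r (f x) < l (g x)" for x y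
    proof -
      have "x \<in> set p" "y \<in> set p" using xy by (auto simp: in_set_vwalk_arcs_iff_nth)
      then have "f x \<in> pverts G" "g x \<in> pverts G"
        using f g p(2) by (auto simp: surj_weak_hom_def weak_hom_def)
      moreover have "(f x, f y) \<in> parcs G \<or> f x = f y" "(g x, g y) \<in> parcs G \<or> g x = g y"
        using f g xy p(3) by (auto simp: surj_weak_hom_def weak_hom_def)
      ultimately have "l (f y) \<le> r (f x)" "l (g x) \<le> r (g y)"
        using arcs intervals by (metis)+
      \<comment> \<open>The chain \<open>l (f y) \<le> r (f x) < l (g x) \<le> r (g y)\<close>
        excludes the second alternative of \<open>disj\<close>.\<close>
      then show ?thesis using disj[OF \<open>y \<in> set p\<close>] \<open>r (f x) < l (g x)\<close> by linarith
    qed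
    have left: "r (f u) < l (g u)" if "u \<in> set p" for u
      using vwalk_arcs_invariant[of p "\<lambda>u. r (f u) < l (g u)", OF step start that] .
    have "Max (l ` pverts G) \<in> l ` pverts G"
      using pair_finite_verts \<open>pverts G \<noteq> {}\<close> by simp
    then obtain v where v: "v \<in> pverts G" "l v = Max (l ` pverts G)" by auto
    \<comment> \<open>Surjectivity of \<open>f\<close> enters here: at \<open>u\<close> the interval
      of \<open>g u\<close> cannot start to the right of that of \<open>f u\<close>.\<close>
    then obtain u where u: "u \<in> set p" "f u = v"
      using f p(2) unfolding surj_weak_hom_def by (metis imageE)
    then have "g u \<in> pverts G" using g p(2) by (auto simp: surj_weak_hom_def)
    then have "l (g u) \<le> l (f u)" using v u pair_finite_verts by simp
    then show False using left[OF u(1)] intervals[OF v(1)] u(2) by simp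
  qed
  show thesis
  proof (rule ccontr)
    assume "\<not> thesis"
    then have "\<forall>u \<in> set p. r (f u) < l (g u) \<or> r (g u) < l (f u)"
      using that p(2) by (metis not_le_imp_less)
    then have disj: "r (f u) < l (g u) \<or> r (g u) < l (f u)" if "u \<in> set p" for u
      using that by blast
    from disj[of "hd p"] p(1) show False
      using never_left[OF f g disj] never_left[OF g f] disj by (meson hd_in_set)
  qed
qed

text \<open>Vertices whose intervals meet are equal or adjacent, hence at distance at most
  1.\<close>

lemma interval_representation_homs_close:
  assumes "interval_representation G I" and "pverts G \<noteq> {}"
    and "path_graph P" and f: "surj_weak_hom P G f" and g: "surj_weak_hom P G g"
  obtains u where "u \<in> pverts P" "gdist G (f u) (g u) \<le> 1"
proof -
  obtain l r where lr: "\<And>v. v \<in> pverts G \<Longrightarrow> l v \<le> r v \<and> I v = {l v..r v}"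
    using assms(1) unfolding interval_representation_def by metis
  have adj: "(u, v) \<in> parcs G \<longleftrightarrow> l u \<le> r v \<and> l v \<le> r u"
    if "u \<in> pverts G" "v \<in> pverts G" "u \<noteq> v" for u v
  proof -
    have "(u, v) \<in> parcs G \<longleftrightarrow> I u \<inter> I v \<noteq> {}"
      using assms(1) that by (simp add: interval_representation_def)
    \<comment> \<open>Two nonempty closed intervals meet exactly when each starts no later than the
      other ends.\<close>
    also have "\<dots> \<longleftrightarrow> l u \<le> r v \<and> l v \<le> r u" using lr[OF that(1)] lr[OF that(2)] by auto
    finally show ?thesis .
  qed
  have "l u \<le> r v \<and> l v \<le> r u" if "(u, v) \<in> parcs G" for u v
    using that adj in_arcsD1 in_arcsD2 no_loops' by blast
  then obtain u where u: "u \<in> pverts P" "l (f u) \<le> r (g u)" "l (g u) \<le> r (f u)"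
    using interval_homs_meet[of l r P f g] lr assms by blast
  then have "f u \<in> pverts G" "g u \<in> pverts G"
    using f g by (auto simp: surj_weak_hom_def)
  then show thesis using that u adj gdist_self_or_adjacent_le_1 by blast
qed

end

theorem theorem3p5:
  fixes G :: "'a pair_pre_digraph"
  assumes "interval_graph G"
    and "Digraph_Component.connected (with_proj G)"
    and "card (pverts G) \<ge> 2"
  shows "strong_vertex_span G = 1"
proof -
  obtain I where "pair_graph G" and I: "interval_representation G I"
    using assms(1) by (auto simp: interval_graph_def)
  then interpret pair_graph G by simp
  have "pverts G \<noteq> {}" using assms(3) by auto
  have path: "finite (pverts P)" "pverts P \<noteq> {}" if "path_graph P" for P :: "nat pair_pre_digraph"
    using that by (auto simp: path_graph_def)
  have le: "hom_dist P G f g \<le> 1"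
    if P: "path_graph P" "surj_weak_hom P G f" "surj_weak_hom P G g" for P :: "nat pair_pre_digraph" and f g
  proof -
    obtain u where "u \<in> pverts P" "gdist G (f u) (g u) \<le> 1"
      using interval_representation_homs_close[OF I \<open>pverts G \<noteq> {}\<close> P] .
    then show ?thesis
      unfolding hom_dist_def using path[OF P(1)] by (auto simp: Min_le_iff)
  qed
  let ?D = "{hom_dist P G f g | (P :: nat pair_pre_digraph) f g.
    path_graph P \<and> surj_weak_hom P G f \<and> surj_weak_hom P G g}"
  \<comment> \<open>\<open>Max\<close> is meaningful only on a finite set. Each minimum is attained
    at a vertex of \<open>P\<close>, so it is one of the finitely many distances in
    \<open>G\<close>.\<close>
  have "?D \<subseteq> (\<lambda>(x, y). gdist G x y) ` (pverts G \<times> pverts G)"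
  proof clarify
    fix P :: "nat pair_pre_digraph" and f g
    assume P: "path_graph P" "surj_weak_hom P G f" "surj_weak_hom P G g"
    have "hom_dist P G f g \<in> (\<lambda>u. gdist G (f u) (g u)) ` pverts P"
      unfolding hom_dist_def using path[OF P(1)] by (intro Min_in) auto
    then obtain u where "u \<in> pverts P" "hom_dist P G f g = gdist G (f u) (g u)" by blast
    then show "hom_dist P G f g \<in> (\<lambda>(x, y). gdist G x y) ` (pverts G \<times> pverts G)"
      using P by (auto simp: surj_weak_hom_def intro!: image_eqI[of _ _ "(f u, g u)"])
  qed
  then have "finite ?D" by (rule finite_subset) simp
  moreover have "1 \<in> ?D"
  proof -
    obtain P :: "nat pair_pre_digraph" and f g where
      P: "path_graph P" "surj_weak_hom P G f" "surj_weak_hom P G g"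
      and ne: "\<And>i. i \<in> pverts P \<Longrightarrow> f i \<noteq> g i"
      using surj_weak_homs_everywhere_distinct[OF assms(2,3)] by blast
    \<comment> \<open>The lower bound holds pointwise; with \<open>le\<close> the value is exactly
      1, so the maximum is attained.\<close>
    have "1 \<le> hom_dist P G f g"
      unfolding hom_dist_def using path[OF P(1)] ne gdist_ge_1 by auto
    then have "hom_dist P G f g = 1" using le[OF P] by simp
    then show ?thesis using P by force
  qed
  ultimately show ?thesis
    unfolding strong_vertex_span_def using le by (intro Max_eqI) auto
qed

end
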